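(* Let $G_d$ be an infinite, connected $d$-regular graph and let $k$ be a positive integer. If $\iota^*(G_d)+2k>d$, then $p(G_d,k)>0$. In particular, if $G_d$ has the anchored expansion property, i.e. $\iota^*(G_d)>0$, then $p(G_d,\lceil d/2\rceil)>0$.
   Context: Bootstrap percolation with the $k$-neighbor rule ($k$-rule) on a countable, connected, locally finite graph $G=(V,E)$: initially each vertex is occupied with probability $p$ and vacant with probability $1-p$, independently of each other (law $\mathbb{P}_p$). Then a deterministic rule is iterated in discrete time: if a vacant vertex has at least $k$ occupied neighbors at some time step, it becomes occupied in the next step; occupied vertices remain occupied. Complete occupation is the event that every vertex eventually becomes occupied. For an infinite graph $G$, the critical probability is $p(G,k)=\inf\{p\in[0,1] : \mathbb{P}_p(\text{complete occupation})>0\}$. Anchored Cheeger constant: for an infinite connected graph $G$ with vertex set $V$ and a fixed vertex $o\in V$, $$\iota^*(G)=\liminf\left\{\frac{|\partial_e S|}{|S|}: o\in S\subset V,\ S\text{ finite and connected}\right\},$$ where $\partial_e S$ is the set of edges with exactly one endpoint in $S$, and the liminf is taken as $|S|\to\infty$, i.e. it equals $\lim_{n\to\infty}\inf\{|\partial_eS|/|S| : o\in S\subset V,\ S \text{ finite and connected},\ |S|\ge n\}$. The value does not depend on $o$. $G$ has the anchored expansion property if $\iota^*(G)>0$. *)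

theory Defs
  imports "HOL-Probability.Probability" "Graph_Theory.Digraph_Component"
begin

text \<open>
  A simple undirected graph is a \<^locale>\<open>pair_bidirected_digraph\<close>: the arcs form a symmetric
  irreflexive relation, and the undirected edge between \<open>u\<close> and \<open>v\<close> is represented by the two arcs
  \<open>(u, v)\<close> and \<open>(v, u)\<close>.

  Topological connectedness and \<^const>\<open>Digraph_Component.connected\<close> have the same base name, so
  the latter is always written in qualified form.
\<close>

text \<open>The finiteness clause matters for \<open>d = 0\<close>, as an infinite set has cardinality \<open>0\<close>.\<close>

definition regular_graph :: "'a pair_pre_digraph \<Rightarrow> nat \<Rightarrow> bool" where
  "regular_graph G d \<longleftrightarrow> (\<forall>v \<in> pverts G. finite (out_arcs (with_proj G) v) \<and> out_degree (with_proj G) v = d)"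


section \<open>Anchored expansion\<close>

definition edge_boundary :: "'a pair_pre_digraph \<Rightarrow> 'a set \<Rightarrow> 'a set set" where
  "edge_boundary G S = {{u, v} |u v. (u, v) \<in> parcs G \<and> u \<in> S \<and> v \<notin> S}"

definition anchored_sets :: "'a pair_pre_digraph \<Rightarrow> 'a \<Rightarrow> 'a set set" where
  "anchored_sets G a =
     {S. a \<in> S \<and> S \<subseteq> pverts G \<and> finite S \<and> Digraph_Component.connected (with_proj G \<restriction> S)}"

text \<open>
  The infima increase with \<open>n\<close>, so the limit always exists in \<^typ>\<open>ereal\<close>; for an infinite, connected,
  locally finite graph they range over nonempty sets.
\<close>

definition anchored_cheeger :: "'a pair_pre_digraph \<Rightarrow> 'a \<Rightarrow> ereal" where
  "anchored_cheeger G a =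
     lim (\<lambda>n. INF S \<in> {S \<in> anchored_sets G a. n \<le> card S}.
       ereal (real (card (edge_boundary G S)) / real (card S)))"

definition anchored_expansion :: "'a pair_pre_digraph \<Rightarrow> 'a \<Rightarrow> bool" where
  "anchored_expansion G a \<longleftrightarrow> anchored_cheeger G a > 0"


section \<open>Bootstrap percolation\<close>

definition configs :: "'a pair_pre_digraph \<Rightarrow> real \<Rightarrow> ('a \<Rightarrow> bool) measure" where
  "configs G p = (\<Pi>\<^sub>M v \<in> pverts G. measure_pmf (bernoulli_pmf p))"

text \<open>
  The set of vertices occupied at a given time, started from the configuration \<open>\<omega>\<close>
  (\<^const>\<open>True\<close> means occupied).
\<close>

primrec occupied :: "'a pair_pre_digraph \<Rightarrow> nat \<Rightarrow> ('a \<Rightarrow> bool) \<Rightarrow> nat \<Rightarrow> 'a set" where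
  "occupied G k \<omega> 0 = {v \<in> pverts G. \<omega> v}"
| "occupied G k \<omega> (Suc t) = occupied G k \<omega> t \<union>
     {v \<in> pverts G. k \<le> card {u \<in> occupied G k \<omega> t. (v, u) \<in> parcs G}}"

definition completely_occupied :: "'a pair_pre_digraph \<Rightarrow> nat \<Rightarrow> ('a \<Rightarrow> bool) \<Rightarrow> bool" where
  "completely_occupied G k \<omega> \<longleftrightarrow> (\<forall>v \<in> pverts G. \<exists>t. v \<in> occupied G k \<omega> t)"

text \<open>
  For a countable, locally finite graph the event is measurable, and it has probability \<open>1\<close> for
  \<open>p = 1\<close>, so the infimum is taken over a nonempty set.
\<close>

definition critical_prob :: "'a pair_pre_digraph \<Rightarrow> nat \<Rightarrow> real" where
  "critical_prob G k =
     Inf {p \<in> {0..1}.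
       measure (configs G p) {\<omega> \<in> space (configs G p). completely_occupied G k \<omega>} > 0}"

end

theory Submission
  imports Defs
begin

text \<open>
  Suppose complete occupation occurs, let \<open>A\<close> be the set of initially occupied vertices and let
  \<open>\<tau> v\<close> be the time at which \<open>v\<close> becomes occupied. Start with any large finite connected set that
  contains the root \<open>a\<close>, and repeatedly add to it all neighbours that became occupied strictly
  earlier than a vertex already present. Since \<open>\<tau>\<close> decreases along the way and degrees are finite,
  this stops at a finite connected set \<open>S\<close> (\<open>rooted_backward_closure\<close>). Every vertex of \<open>S - A\<close> has at
  least \<open>k\<close> neighbours of smaller time, and they all lie in \<open>S\<close>, so \<open>S\<close> spans at least
  \<open>k |S - A|\<close> edges. As the degrees in \<open>S\<close> sum to \<open>d |S|\<close>, this gives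
  \<open>|\<partial>S| + 2 k |S| \<le> d |S| + 2 k |S \<inter> A|\<close>
  (\<open>completely_occupied_rooted\<close>). If the anchored Cheeger constant exceeds \<open>d - 2 k\<close>, then
  \<open>|\<partial>S| + 2 k |S| - d |S|\<close> is at least a positive multiple of \<open>|S|\<close> for all large \<open>S\<close>, so a
  fixed positive fraction \<open>1 / m\<close> of \<open>S\<close> is initially occupied (\<open>cheeger_density\<close>). Thus complete
  occupation forces such dense connected sets around \<open>a\<close> of arbitrarily large size.

  For small \<open>p\<close> this has probability zero. A connected set is the vertex set of a walk from \<open>a\<close> that
  traverses a spanning tree, so at most \<open>d ^ (2 * n)\<close> connected sets of size \<open>n\<close> contain \<open>a\<close>
  (\<open>card_rooted\<close>). Each has at most \<open>2 ^ n\<close> subsets of size at least \<open>n / m\<close>, and each of these is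
  fully occupied with probability at most \<open>p powr (n / m)\<close>. When \<open>p \<le> (1 / (4 * d^2)) ^ m\<close> the
  resulting bound \<open>(1 / 2) ^ n\<close> is summable, and the Borel-Cantelli lemma applies
  (\<open>no_complete_occupation\<close>).

  The critical probability is an infimum of real numbers, so a lower bound on the members of the
  set is useful only if the set is nonempty: \<open>complete_occupation_at_one\<close> shows that it contains
  \<open>1\<close>, which includes the measurability of complete occupation.

  The second claim is the case \<open>k = \<lceil>d / 2\<rceil>\<close>, where \<open>2 k \<ge> d\<close>.
\<close>

section \<open>Finite connected sets containing a vertex\<close>

locale infinite_regular_graph = pair_bidirected_digraph G
  for G :: "'a pair_pre_digraph" +
  fixes d :: nat and a :: 'a
  assumes infinite_verts: "infinite (pverts G)"
    and connected_graph: "Digraph_Component.connected (with_proj G)"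
    and regular: "regular_graph G d"
    and root: "a \<in> pverts G"
begin

text \<open>
  The finite connected sets that contain the root, with connectivity expressed by paths from the
  root only. This is easier to establish and to use in inductions than strong connectivity of the
  induced subgraph, and it implies it (\<open>rooted_in_anchored_sets\<close>).
\<close>

definition rooted :: "'a set \<Rightarrow> bool" where
  "rooted S \<longleftrightarrow> finite S \<and> a \<in> S \<and> S \<subseteq> pverts G \<and> (\<forall>x\<in>S. (a, x) \<in> (parcs G \<inter> S \<times> S)\<^sup>*)"

lemma arc_sym: "(u, v) \<in> parcs G \<Longrightarrow> (v, u) \<in> parcs G"
  using graph_symmetric by simp

lemma arc_verts: "(u, v) \<in> parcs G \<Longrightarrow> u \<in> pverts G \<and> v \<in> pverts G"
  by (auto dest: in_arcsD1 in_arcsD2)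

lemma out_arcs_image: "out_arcs (with_proj G) v = Pair v ` {u. (v, u) \<in> parcs G}"
  by (auto simp: out_arcs_def)

lemma neighbours:
  assumes "v \<in> pverts G"
  shows finite_neighbours: "finite {u. (v, u) \<in> parcs G}"
    and card_neighbours: "card {u. (v, u) \<in> parcs G} = d"
proof -
  have *: "finite (out_arcs (with_proj G) v)" "card (out_arcs (with_proj G) v) = d"
    using regular assms by (auto simp: regular_graph_def out_degree_def)
  show "finite {u. (v, u) \<in> parcs G}"
    using *(1) unfolding out_arcs_image by (rule finite_imageD) (auto simp: inj_on_def)
  show "card {u. (v, u) \<in> parcs G} = d"
    using *(2) unfolding out_arcs_image by (subst (asm) card_image) (auto simp: inj_on_def)
qed

lemma rooted_in_anchored_sets:
  assumes S: "rooted S"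
  shows "S \<in> anchored_sets G a"
proof -
  let ?H = "with_proj G \<restriction> S"
  have sub: "parcs G \<inter> S \<times> S \<subseteq> parcs (mk_symmetric ?H)"
    by (force simp: parcs_mk_symmetric)
  have fwd: "(a, x) \<in> rtrancl_on S (parcs G \<inter> S \<times> S)" if "x \<in> S" for x
  proof -
    have "(a, x) \<in> (parcs G \<inter> S \<times> S)\<^sup>*" using S that by (auto simp: rooted_def)
    then show ?thesis
    proof induction
      case base then show ?case using S by (auto simp: rooted_def)
    next
      case (step y z) then show ?case by (auto intro: rtrancl_on_into_rtrancl_on)
    qed
  qed
  have bwd: "(x, a) \<in> rtrancl_on S (parcs G \<inter> S \<times> S)" if "x \<in> S" for x
  proof -
    have "(parcs G \<inter> S \<times> S)\<inverse> = parcs G \<inter> S \<times> S" by (auto dest: arc_sym)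
    then show ?thesis using rtrancl_on_converseI[OF fwd[OF that]] by simp
  qed
  have "u \<rightarrow>\<^sup>*\<^bsub>with_proj (mk_symmetric ?H)\<^esub> v" if "u \<in> S" "v \<in> S" for u v
    unfolding reachable_def
    using rtrancl_on_mono[OF sub subset_refl rtrancl_on_trans[OF bwd[OF that(1)] fwd[OF that(2)]]]
    by simp
  then have "Digraph_Component.connected ?H"
    using S by (auto simp: Digraph_Component.connected_def rooted_def intro!: strongly_connectedI)
  then show ?thesis using S by (auto simp: anchored_sets_def rooted_def)
qed

lemma reachable_from_root:
  assumes "x \<in> pverts G"
  shows "(a, x) \<in> (parcs G)\<^sup>*"
proof -
  have "strongly_connected (with_proj G)"
    using symmetric_connected_imp_strongly_connected[OF _ connected_graph] pair_sym_arcs by simp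
  then have "a \<rightarrow>\<^sup>*\<^bsub>with_proj G\<^esub> x" using assms root by (auto simp: strongly_connected_def)
  then show ?thesis using rtrancl_on_rtranclI by (auto simp: reachable_def)
qed

end

lemma rtrancl_leaves_set:
  assumes "(x, y) \<in> R\<^sup>*" "x \<in> S" "y \<notin> S"
  obtains u w where "(u, w) \<in> R" "u \<in> S" "w \<notin> S"
proof -
  have "y \<notin> S \<longrightarrow> (\<exists>u w. (u, w) \<in> R \<and> u \<in> S \<and> w \<notin> S)"
    using assms(1) by induction (use assms(2) in auto)
  then show ?thesis using that assms(3) by blast
qed

context infinite_regular_graph
begin

lemma leaving_arc:
  assumes "finite S" "a \<in> S"
  obtains u w where "(u, w) \<in> parcs G" "u \<in> S" "w \<notin> S"
proof -
  obtain x where "x \<in> pverts G" "x \<notin> S"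
    using infinite_verts assms(1) by (meson finite_subset subsetI)
  then show ?thesis
    using rtrancl_leaves_set[OF reachable_from_root assms(2)] that by metis
qed

lemma degree_pos: "d > 0"
proof -
  obtain u w where "(u, w) \<in> parcs G"
    by (rule leaving_arc[of "{a}"]) auto
  then have "{u'. (u, u') \<in> parcs G} \<noteq> {}" "u \<in> pverts G" by (auto dest: arc_verts)
  then show ?thesis using neighbours[of u] by (metis card_gt_0_iff)
qed

text \<open>
  Connectivity of a superset needs to be checked only from some point of the old set, because paths
  inside \<open>T\<close> are paths inside \<open>S\<close>.
\<close>

lemma rooted_extend:
  assumes T: "rooted T" and "T \<subseteq> S" "finite S" "S \<subseteq> pverts G"
    and reach: "\<And>x. x \<in> S \<Longrightarrow> \<exists>v\<in>T. (v, x) \<in> (parcs G \<inter> S \<times> S)\<^sup>*"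
  shows "rooted S"
proof -
  have "(a, x) \<in> (parcs G \<inter> S \<times> S)\<^sup>*" if x: "x \<in> S" for x
  proof -
    obtain v where v: "v \<in> T" "(v, x) \<in> (parcs G \<inter> S \<times> S)\<^sup>*" using reach[OF x] by blast
    have "(a, v) \<in> (parcs G \<inter> T \<times> T)\<^sup>*" using T v by (auto simp: rooted_def)
    moreover have "(parcs G \<inter> T \<times> T)\<^sup>* \<subseteq> (parcs G \<inter> S \<times> S)\<^sup>*"
      by (rule rtrancl_mono) (use \<open>T \<subseteq> S\<close> in auto)
    ultimately show ?thesis using v by (meson rtrancl_trans subsetD)
  qed
  then show ?thesis using assms by (auto simp: rooted_def)
qed

text \<open>
  Since the graph is infinite and connected, an arc leaves every finite set containing the root, and
  its endpoint can be added.
\<close>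

lemma exists_rooted: "\<exists>S. rooted S \<and> card S = Suc n"
proof (induction n)
  case 0
  have "rooted {a}" using root by (auto simp: rooted_def)
  then show ?case by (intro exI[of _ "{a}"]) auto
next
  case (Suc n)
  then obtain S where S: "rooted S" "card S = Suc n" by blast
  then have fin: "finite S" "a \<in> S" "S \<subseteq> pverts G" by (auto simp: rooted_def)
  obtain u w where uw: "(u, w) \<in> parcs G" "u \<in> S" "w \<notin> S"
    using leaving_arc[OF fin(1,2)] by metis
  have "rooted (insert w S)"
  proof (rule rooted_extend[OF S(1)])
    fix x assume "x \<in> insert w S"
    then show "\<exists>v\<in>S. (v, x) \<in> (parcs G \<inter> insert w S \<times> insert w S)\<^sup>*"
    proof
      assume "x = w"
      then have "(u, x) \<in> parcs G \<inter> insert w S \<times> insert w S" using uw by auto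
      then show ?thesis using uw(2) by blast
    qed blast
  qed (use fin uw in \<open>auto dest: arc_verts\<close>)
  then show ?case using S fin uw by (intro exI[of _ "insert w S"]) auto
qed

section \<open>Counting connected sets\<close>

text \<open>
  Lists are built at their head, so a walk ends at the root instead of starting there.
\<close>

definition walks :: "nat \<Rightarrow> 'a list set" where
  "walks n = {ws. length ws = Suc n \<and> last ws = a \<and> successively (\<lambda>u v. (u, v) \<in> parcs G) ws}"

lemma walk_verts: "ws \<in> walks n \<Longrightarrow> hd ws \<in> pverts G"
proof (cases ws)
  case (Cons w vs)
  assume "ws \<in> walks n"
  then show ?thesis using Cons root
    by (cases vs) (auto simp: walks_def dest: arc_verts)
qed (simp add: walks_def)

lemma card_walks: "finite (walks n) \<and> card (walks n) \<le> d ^ n"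
proof (induction n)
  case 0
  have "walks 0 \<subseteq> {[a]}" by (auto simp: walks_def length_Suc_conv)
  then show ?case using card_mono[of "{[a]}" "walks 0"] finite_subset by auto
next
  case (Suc n)
  let ?ext = "\<lambda>ws. (\<lambda>w. w # ws) ` {w. (hd ws, w) \<in> parcs G}"
  have sub: "walks (Suc n) \<subseteq> (\<Union>ws\<in>walks n. ?ext ws)"
  proof
    fix ws assume "ws \<in> walks (Suc n)"
    then obtain w x vs where "ws = w # x # vs" "x # vs \<in> walks n" "(w, x) \<in> parcs G"
      by (auto simp: walks_def length_Suc_conv)
    then show "ws \<in> (\<Union>ws\<in>walks n. ?ext ws)"
      by (intro UN_I[of "x # vs"]) (auto dest: arc_sym)
  qed
  have fin: "finite (?ext ws)" "card (?ext ws) \<le> d" if "ws \<in> walks n" for ws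
    using finite_neighbours[OF walk_verts[OF that]] card_neighbours[OF walk_verts[OF that]]
      card_image_le[of "{w. (hd ws, w) \<in> parcs G}" "\<lambda>w. w # ws"] by (blast, simp)
  have finU: "finite (\<Union>ws\<in>walks n. ?ext ws)" using Suc fin(1) by blast
  have "card (walks (Suc n)) \<le> card (\<Union>ws\<in>walks n. ?ext ws)"
    by (rule card_mono[OF finU sub])
  also have "\<dots> \<le> (\<Sum>ws\<in>walks n. card (?ext ws))"
    using Suc by (intro card_UN_le) auto
  also have "\<dots> \<le> (\<Sum>ws\<in>walks n. d)" by (intro sum_mono fin)
  also have "\<dots> \<le> d ^ Suc n" using Suc by (simp add: mult.commute)
  finally show ?case using finite_subset[OF sub finU] by blast
qed

text \<open>
  A walk covering part of \<open>S\<close> is enlarged by one vertex \<open>w\<close> of \<open>S\<close> by a detour of two steps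
  \<open>x, w, x\<close> at a vertex \<open>x\<close> adjacent to \<open>w\<close> that it visits already. Hence \<open>2 * j\<close> steps reach
  \<open>Suc j\<close> vertices.
\<close>

lemma rooted_walk:
  assumes S: "rooted S"
  shows "Suc j \<le> card S \<Longrightarrow> \<exists>ws\<in>walks (2 * j). set ws \<subseteq> S \<and> card (set ws) = Suc j"
proof (induction j)
  case 0
  then show ?case using S by (intro bexI[of _ "[a]"]) (auto simp: walks_def rooted_def)
next
  case (Suc j)
  then obtain ws where ws: "ws \<in> walks (2 * j)" "set ws \<subseteq> S" "card (set ws) = Suc j" by auto
  have "ws \<noteq> []" "last ws = a" using ws(1) by (auto simp: walks_def)
  then have "a \<in> set ws" using last_in_set by blast
  obtain y where y: "y \<in> S" "y \<notin> set ws"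
    using Suc.prems ws by (metis not_less_eq_eq subsetI card_mono List.finite_set le_refl)
  have "(a, y) \<in> (parcs G \<inter> S \<times> S)\<^sup>*" using S y by (auto simp: rooted_def)
  then obtain x w where xw: "(x, w) \<in> parcs G" "w \<in> S" "x \<in> set ws" "w \<notin> set ws"
    using rtrancl_leaves_set[OF _ \<open>a \<in> set ws\<close> y(2)] by (metis IntE mem_Sigma_iff)
  obtain us vs where split: "ws = us @ x # vs" using split_list[OF xw(3)] by blast
  have "us @ x # w # x # vs \<in> walks (2 * Suc j)"
    using ws(1) xw(1) arc_sym[OF xw(1)] unfolding split walks_def
    by (auto simp: successively_append_iff)
  moreover have "set (us @ x # w # x # vs) = insert w (set ws)" using split by auto
  ultimately show ?case using ws xw
    by (intro bexI[of _ "us @ x # w # x # vs"]) auto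
qed

text \<open>
  By \<open>rooted_walk\<close>, the map taking a walk of \<open>2 * (n - 1)\<close> steps to its set of vertices covers
  all these sets.
\<close>

lemma card_rooted:
  shows "finite {S. rooted S \<and> card S = n}" and "card {S. rooted S \<and> card S = n} \<le> d ^ (2 * n)"
proof -
  have *: "finite {S. rooted S \<and> card S = n} \<and> card {S. rooted S \<and> card S = n} \<le> d ^ (2 * n)"
  proof (cases n)
    case 0
    then have empty: "{S. rooted S \<and> card S = n} = {}" by (auto simp: rooted_def)
    show ?thesis unfolding empty by simp
  next
    case (Suc j)
    have sub: "{S. rooted S \<and> card S = n} \<subseteq> set ` walks (2 * j)"
    proof
      fix S assume "S \<in> {S. rooted S \<and> card S = n}"
      then have S: "rooted S" "card S = Suc j" "finite S" using Suc by (auto simp: rooted_def)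
      from rooted_walk[OF S(1), of j] obtain ws
        where "ws \<in> walks (2 * j)" "set ws \<subseteq> S" "card (set ws) = Suc j"
        using S(2) by auto
      with S show "S \<in> set ` walks (2 * j)" by (metis card_subset_eq image_eqI)
    qed
    have "card {S. rooted S \<and> card S = n} \<le> card (set ` walks (2 * j))"
      using sub card_walks by (intro card_mono) auto
    also have "\<dots> \<le> card (walks (2 * j))" using card_walks by (intro card_image_le) auto
    also have "\<dots> \<le> d ^ (2 * j)" using card_walks by blast
    also have "\<dots> \<le> d ^ (2 * n)" using degree_pos Suc by (intro power_increasing) auto
    finally have "card {S. rooted S \<and> card S = n} \<le> d ^ (2 * n)" .
    moreover have "finite {S. rooted S \<and> card S = n}"
      by (rule finite_subset[OF sub]) (simp add: card_walks)
    ultimately show ?thesis by (intro conjI)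
  qed
  then show "finite {S. rooted S \<and> card S = n}"
    "card {S. rooted S \<and> card S = n} \<le> d ^ (2 * n)" by auto
qed

section \<open>Connected sets rich in initially occupied vertices\<close>

text \<open>
  Each vertex has finitely many neighbours and \<open>\<tau>\<close> is strictly decreasing along the relation, so
  this follows by induction on the value of \<open>\<tau>\<close>.
\<close>

lemma finite_descent:
  fixes \<tau> :: "'a \<Rightarrow> nat"
  defines "R \<equiv> {(v, u) \<in> parcs G. \<tau> u < \<tau> v}"
  assumes "v \<in> pverts G"
  shows "finite (R\<^sup>* `` {v})"
  using assms(2)
proof (induction "\<tau> v" arbitrary: v rule: less_induct)
  case less
  have sub: "R\<^sup>* `` {v} \<subseteq> insert v (\<Union>u\<in>R `` {v}. R\<^sup>* `` {u})"
    by (auto elim: converse_rtranclE)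
  have "R `` {v} \<subseteq> {u. (v, u) \<in> parcs G}" by (auto simp: R_def)
  then have "finite (R `` {v})" using finite_neighbours[OF less.prems] finite_subset by blast
  moreover have "finite (R\<^sup>* `` {u})" if "u \<in> R `` {v}" for u
    using that by (intro less.hyps) (auto simp: R_def dest: arc_verts)
  ultimately show ?case using sub finite_subset by blast
qed

text \<open>
  The set is everything reachable from \<open>T\<close> along arcs on which \<open>\<tau>\<close> decreases. The path that brings
  in a vertex lies in this set, which is why it stays connected.
\<close>

lemma rooted_backward_closure:
  fixes \<tau> :: "'a \<Rightarrow> nat"
  assumes T: "rooted T"
  obtains S where "rooted S" "T \<subseteq> S"
    "\<And>v u. v \<in> S \<Longrightarrow> (v, u) \<in> parcs G \<Longrightarrow> \<tau> u < \<tau> v \<Longrightarrow> u \<in> S"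
proof
  define R where "R = {(v, u) \<in> parcs G. \<tau> u < \<tau> v}"
  have T': "finite T" "T \<subseteq> pverts G" using T by (auto simp: rooted_def)
  have step: "u \<in> R\<^sup>* `` T" if "v \<in> R\<^sup>* `` T" "(v, u) \<in> R" for u v
    using that by (blast intro: rtrancl_into_rtrancl)
  have eq: "R\<^sup>* `` T = (\<Union>v\<in>T. R\<^sup>* `` {v})" by auto
  show sub: "T \<subseteq> R\<^sup>* `` T" by auto
  show "rooted (R\<^sup>* `` T)"
  proof (rule rooted_extend[OF T sub])
    show "finite (R\<^sup>* `` T)"
      unfolding eq using T' finite_descent[of _ \<tau>] by (auto simp: R_def)
    have "u \<in> pverts G" if "(v, u) \<in> R\<^sup>*" "v \<in> T" for u v
      using that T' by (cases rule: rtranclE) (auto simp: R_def dest: arc_verts)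
    then show "R\<^sup>* `` T \<subseteq> pverts G" by auto
    fix x assume "x \<in> R\<^sup>* `` T"
    then obtain v where v: "v \<in> T" "(v, x) \<in> R\<^sup>*" by auto
    from v(2) have "(v, x) \<in> (parcs G \<inter> (R\<^sup>* `` T) \<times> (R\<^sup>* `` T))\<^sup>*"
    proof induction
      case (step y z)
      have "y \<in> R\<^sup>* `` T" "z \<in> R\<^sup>* `` T" using v(1) step(1,2) by (auto intro: rtrancl_into_rtrancl)
      moreover have "(y, z) \<in> parcs G" using step(2) by (auto simp: R_def)
      ultimately show ?case using step(3) by (meson IntI SigmaI rtrancl_into_rtrancl)
    qed auto
    then show "\<exists>v\<in>T. (v, x) \<in> (parcs G \<inter> (R\<^sup>* `` T) \<times> (R\<^sup>* `` T))\<^sup>*" using v(1) by blast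
  qed
  show "u \<in> R\<^sup>* `` T" if "v \<in> R\<^sup>* `` T" "(v, u) \<in> parcs G" "\<tau> u < \<tau> v" for u v
    using step[OF that(1)] that by (auto simp: R_def)
qed

text \<open>
  There are \<open>d * card S\<close> arcs starting in \<open>S\<close>. Those that leave \<open>S\<close> account for the boundary, and
  every inner arc along which \<open>\<tau>\<close> decreases is paired with its reversal, along which \<open>\<tau>\<close>
  increases; these three kinds of arcs are disjoint.
\<close>

lemma boundary_plus_oriented_arcs:
  fixes \<tau> :: "'a \<Rightarrow> nat"
  assumes S: "finite S" "S \<subseteq> pverts G"
  shows "card (edge_boundary G S) + 2 * card {(v, u) \<in> parcs G \<inter> S \<times> S. \<tau> u < \<tau> v} \<le> d * card S"
proof -
  let ?all = "SIGMA v:S. {u. (v, u) \<in> parcs G}"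
  let ?out = "{(v, u) \<in> parcs G. v \<in> S \<and> u \<notin> S}"
  let ?down = "{(v, u) \<in> parcs G \<inter> S \<times> S. \<tau> u < \<tau> v}"
  let ?up = "{(v, u) \<in> parcs G \<inter> S \<times> S. \<tau> v < \<tau> u}"
  have fin: "finite ?all" using S finite_neighbours by (intro finite_SigmaI) auto
  have fins: "finite ?out" "finite ?down" "finite ?up"
    by (rule finite_subset[OF _ fin]; auto)+
  have "edge_boundary G S = (\<lambda>(v, u). {v, u}) ` ?out"
    by (auto simp: edge_boundary_def image_iff)
  then have bd: "card (edge_boundary G S) \<le> card ?out" using card_image_le[OF fins(1)] by simp
  have "?up = prod.swap ` ?down" by (force dest: arc_sym)
  then have up: "card ?up = card ?down" by (simp add: card_image)
  \<comment> \<open>Inner arcs between vertices with equal \<open>\<tau>\<close> are dropped, so only an inequality remains.\<close>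
  have "card ?out + (card ?down + card ?up) = card (?out \<union> (?down \<union> ?up))"
  proof -
    have "?down \<inter> ?up = {}" "?out \<inter> (?down \<union> ?up) = {}" by auto
    then show ?thesis using fins by (simp only: card_Un_disjoint finite_Un simp_thms)
  qed
  also have "\<dots> \<le> card ?all" by (intro card_mono fin) auto
  also have "\<dots> = (\<Sum>v\<in>S. d)"
    using S neighbours by (subst card_SigmaI) (auto simp del: sum_constant intro!: sum.cong)
  finally show ?thesis using bd up by (simp add: mult.commute)
qed

text \<open>
  The rule fires for \<open>v\<close> one step before \<open>\<tau> v\<close>, so the neighbours that make it fire have a strictly
  smaller time.
\<close>

lemma first_time_neighbours:
  fixes \<omega> k
  defines "\<tau> \<equiv> \<lambda>v. LEAST t. v \<in> occupied G k \<omega> t"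
  assumes v: "v \<in> occupied G k \<omega> t" and "\<not> \<omega> v"
  shows "k \<le> card {u. (v, u) \<in> parcs G \<and> \<tau> u < \<tau> v}"
proof -
  have occ: "v \<in> occupied G k \<omega> (\<tau> v)" unfolding \<tau>_def using v by (rule LeastI)
  then have "\<tau> v \<noteq> 0" using \<open>\<not> \<omega> v\<close> by (metis (mono_tags) mem_Collect_eq occupied.simps(1))
  then obtain s where s: "\<tau> v = Suc s" by (cases "\<tau> v") auto
  have "v \<notin> occupied G k \<omega> s" using s not_less_Least[of s "\<lambda>t. v \<in> occupied G k \<omega> t"] by (simp add: \<tau>_def)
  then have vV: "v \<in> pverts G" and k: "k \<le> card {u \<in> occupied G k \<omega> s. (v, u) \<in> parcs G}"
    using occ s by auto
  have "\<tau> u \<le> s" if "u \<in> occupied G k \<omega> s" for u using that by (simp add: \<tau>_def Least_le)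
  then have "{u \<in> occupied G k \<omega> s. (v, u) \<in> parcs G} \<subseteq> {u. (v, u) \<in> parcs G \<and> \<tau> u < \<tau> v}"
    using s by (auto simp: less_Suc_eq_le)
  then show ?thesis using k
    by (rule_tac le_trans[OF _ card_mono]) (auto intro: finite_subset[OF _ finite_neighbours[OF vV]])
qed

text \<open>
  Apply the backward closure to a large connected set and count the arcs from the initially vacant
  vertices of the result to their earlier neighbours.
\<close>

lemma completely_occupied_rooted:
  assumes "completely_occupied G k \<omega>"
  obtains S where "rooted S" "n \<le> card S"
    "card (edge_boundary G S) + 2 * k * card S \<le> d * card S + 2 * k * card {v \<in> S. \<omega> v}"
proof -
  define \<tau> where "\<tau> = (\<lambda>v. LEAST t. v \<in> occupied G k \<omega> t)"
  obtain T where T: "rooted T" "card T = Suc n" using exists_rooted by blast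
  obtain S where S: "rooted S" "T \<subseteq> S"
    and closed: "\<And>v u. v \<in> S \<Longrightarrow> (v, u) \<in> parcs G \<Longrightarrow> \<tau> u < \<tau> v \<Longrightarrow> u \<in> S"
    using rooted_backward_closure[OF T(1), of \<tau>] by metis
  have S': "finite S" "S \<subseteq> pverts G" using S by (auto simp: rooted_def)
  let ?down = "{(v, u) \<in> parcs G \<inter> S \<times> S. \<tau> u < \<tau> v}"
  let ?nb = "\<lambda>v. {u. (v, u) \<in> parcs G \<and> \<tau> u < \<tau> v}"
  let ?vac = "{v \<in> S. \<not> \<omega> v}"
  have fin: "finite (?nb v)" if "v \<in> S" for v
    using finite_neighbours S' that by (auto intro: rev_finite_subset)
  have "k * card ?vac = (\<Sum>v\<in>?vac. k)" by simp
  also have "\<dots> \<le> (\<Sum>v\<in>?vac. card (?nb v))"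
  proof (rule sum_mono)
    fix v assume "v \<in> ?vac"
    moreover from this obtain t where "v \<in> occupied G k \<omega> t"
      using assms S' by (auto simp: completely_occupied_def)
    ultimately show "k \<le> card (?nb v)" unfolding \<tau>_def by (intro first_time_neighbours) auto
  qed
  also have "\<dots> = card (SIGMA v:?vac. ?nb v)" using S' fin by (subst card_SigmaI) auto
  also have "\<dots> \<le> card ?down"
    using S' closed by (intro card_mono finite_subset[of ?down "S \<times> S"]) auto
  finally have "k * card ?vac \<le> card ?down" .
  moreover have "card S = card ?vac + card {v \<in> S. \<omega> v}"
    using S' by (subst card_Un_disjoint[symmetric]) (auto intro!: arg_cong[where f = card])
  ultimately have "card (edge_boundary G S) + 2 * k * card S \<le> d * card S + 2 * k * card {v \<in> S. \<omega> v}"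
    using boundary_plus_oriented_arcs[OF S', of \<tau>] by (simp add: algebra_simps)
  moreover have "n \<le> card S" using T S S' card_mono[of S T] by simp
  ultimately show ?thesis using that S(1) by blast
qed

text \<open>
  Pick \<open>c\<close> strictly between \<open>d - 2 * k\<close> and the Cheeger constant. For large \<open>S\<close> the boundary
  exceeds \<open>c * card S\<close>, and the assumed inequality becomes
  \<open>(c + 2 * k - d) * card S \<le> 2 * k * b\<close>, where the factor on the left is positive. The natural
  number \<open>b\<close> stands for the number of initially occupied vertices of \<open>S\<close>.
\<close>

lemma cheeger_density:
  assumes k: "k > 0" and cheeger: "anchored_cheeger G a + ereal (2 * real k) > ereal (real d)"
  obtains m N where
    "\<And>S b. S \<in> anchored_sets G a \<Longrightarrow> N \<le> card S \<Longrightarrow> card S > 0 \<Longrightarrow>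
       card (edge_boundary G S) + 2 * k * card S \<le> d * card S + 2 * k * b \<Longrightarrow> card S \<le> m * b"
proof -
  define f where "f = (\<lambda>n. INF S \<in> {S \<in> anchored_sets G a. n \<le> card S}.
       ereal (real (card (edge_boundary G S)) / real (card S)))"
  have "incseq f" unfolding f_def by (intro monoI INF_superset_mono) auto
  then have "anchored_cheeger G a = (SUP n. f n)"
    unfolding anchored_cheeger_def f_def[symmetric] by (intro limI LIMSEQ_SUP)
  moreover have "ereal (real d - 2 * real k) < anchored_cheeger G a"
    using cheeger by (cases "anchored_cheeger G a") auto
  ultimately obtain N where "ereal (real d - 2 * real k) < f N" by (auto simp: less_SUP_iff)
  then obtain c where c: "real d - 2 * real k < c" "ereal c < f N"
    using ereal_dense2 by (metis less_ereal.simps(1))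
  define e where "e = c + 2 * real k - real d"
  have e: "e > 0" using c by (simp add: e_def)
  obtain m :: nat where m: "2 * real k / e \<le> real m" using real_arch_simple by blast
  have "card S \<le> m * b" if S: "S \<in> anchored_sets G a" "N \<le> card S" "card S > 0"
    and le: "card (edge_boundary G S) + 2 * k * card S \<le> d * card S + 2 * k * b" for S b
  proof -
    have "ereal c < ereal (real (card (edge_boundary G S)) / real (card S))"
      using c(2) unfolding f_def by (rule less_INF_D) (use S in auto)
    then have "c * real (card S) < real (card (edge_boundary G S))" using S(3) by (simp add: field_simps)
    moreover have "real (card (edge_boundary G S)) + 2 * real k * real (card S)
        \<le> real d * real (card S) + 2 * real k * real b"
      using of_nat_mono[OF le, where ?'a = real] by simp
    ultimately have "e * real (card S) \<le> 2 * real k * real b" by (simp add: e_def algebra_simps)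
    also have "\<dots> \<le> (e * real m) * real b"
      using m e by (intro mult_right_mono) (auto simp: field_simps)
    finally have "real (card S) \<le> real (m * b)" using e by simp
    then show ?thesis by (simp only: of_nat_le_iff)
  qed
  then show ?thesis using that by blast
qed

section \<open>Subcriticality for small densities\<close>

lemma prob_space_configs: "prob_space (configs G p)"
  unfolding configs_def by (intro prob_space_PiM measure_pmf.prob_space_axioms)

lemma space_configs: "space (configs G p) = (\<Pi>\<^sub>E v \<in> pverts G. UNIV)"
  by (simp add: configs_def space_PiM)

lemma measurable_coordinate:
  assumes "v \<in> pverts G"
  shows "Measurable.pred (configs G p) (\<lambda>\<omega>. \<omega> v)"
proof -
  have "(\<lambda>\<omega>. \<omega> v) \<in> measurable (configs G p) (measure_pmf (bernoulli_pmf p))"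
    unfolding configs_def by (rule measurable_component_singleton[OF assms])
  then show ?thesis by (simp add: pred_def measurable_def)
qed

lemma all_occupied:
  assumes B: "finite B" "B \<subseteq> pverts G" and p: "0 \<le> p" "p \<le> 1"
  shows "{\<omega> \<in> space (configs G p). \<forall>v\<in>B. \<omega> v} \<in> sets (configs G p)"
    and "measure (configs G p) {\<omega> \<in> space (configs G p). \<forall>v\<in>B. \<omega> v} = p ^ card B"
proof -
  interpret product_prob_space "\<lambda>_. measure_pmf (bernoulli_pmf p)" "pverts G"
    by unfold_locales
  have "restrict \<omega> B = (\<lambda>v\<in>B. True) \<longleftrightarrow> (\<forall>v\<in>B. \<omega> v)" for \<omega>
    by (auto simp: restrict_def fun_eq_iff)
  then have eq: "{\<omega> \<in> space (configs G p). \<forall>v\<in>B. \<omega> v}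
      = prod_emb (pverts G) (\<lambda>_. measure_pmf (bernoulli_pmf p)) B (\<Pi>\<^sub>E v\<in>B. {True})"
    by (auto simp: prod_emb_def space_configs)
  show "{\<omega> \<in> space (configs G p). \<forall>v\<in>B. \<omega> v} \<in> sets (configs G p)"
    unfolding eq unfolding configs_def using B by (intro sets_PiM_I) auto
  show "measure (configs G p) {\<omega> \<in> space (configs G p). \<forall>v\<in>B. \<omega> v} = p ^ card B"
    unfolding eq unfolding configs_def using B p
    by (subst measure_PiM_emb) (auto simp: measure_pmf_single)
qed

text \<open>
  The event that in some connected set of size \<open>n\<close> around the root at least a fraction \<open>1 / m\<close> of
  the vertices is occupied. It is written as a finite union over the possible sets \<open>B\<close> of occupied
  vertices, which shows that it is measurable and lends itself to a union bound.
\<close>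

definition dense_event :: "real \<Rightarrow> nat \<Rightarrow> nat \<Rightarrow> ('a \<Rightarrow> bool) set" where
  "dense_event p m n = (\<Union>S \<in> {S. rooted S \<and> card S = n}. \<Union>B \<in> {B. B \<subseteq> S \<and> n \<le> m * card B}.
     {\<omega> \<in> space (configs G p). \<forall>v\<in>B. \<omega> v})"

text \<open>
  Union bound over at most \<open>d ^ (2 * n)\<close> sets \<open>S\<close> and \<open>2 ^ n\<close> sets \<open>B\<close>. With
  \<open>c = 1 / (4 * d^2)\<close> each event has probability at most \<open>c ^ (m * card B) \<le> c ^ n\<close>, and \<open>c\<close> is
  chosen so that \<open>d^2 * 2 * c = 1 / 2\<close>. Taking \<open>p\<close> below an \<open>m\<close>-th power avoids real exponents.
\<close>

lemma dense_event:
  assumes p: "0 \<le> p" "p \<le> (1 / (4 * real d ^ 2)) ^ m"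
  shows "dense_event p m n \<in> sets (configs G p)"
    and "measure (configs G p) (dense_event p m n) \<le> (1 / 2) ^ n"
proof -
  interpret prob_space "configs G p" by (rule prob_space_configs)
  define c where "c = 1 / (4 * real d ^ 2)"
  have d: "1 \<le> real d ^ 2" using degree_pos by simp
  then have c: "0 \<le> c" "c \<le> 1" by (auto simp: c_def divide_le_eq)
  have p1: "p \<le> 1" using p(2) power_le_one[OF c, of m] by (simp add: c_def)
  let ?\<S> = "{S. rooted S \<and> card S = n}"
  let ?\<B> = "\<lambda>S. {B. B \<subseteq> S \<and> n \<le> m * card B}"
  let ?E = "\<lambda>B. {\<omega> \<in> space (configs G p). \<forall>v\<in>B. \<omega> v}"
  have fin: "finite (?\<B> S)" "card (?\<B> S) \<le> 2 ^ n" if "S \<in> ?\<S>" for S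
  proof -
    have S: "finite S" "card S = n" using that by (auto simp: rooted_def)
    have "?\<B> S \<subseteq> Pow S" by auto
    then show "finite (?\<B> S)" "card (?\<B> S) \<le> 2 ^ n"
      using S card_mono[of "Pow S" "?\<B> S"] finite_subset[of "?\<B> S" "Pow S"]
      by (auto simp: card_Pow)
  qed
  have B: "finite B" "B \<subseteq> pverts G" if "S \<in> ?\<S>" "B \<in> ?\<B> S" for S B
    using that finite_subset by (auto simp: rooted_def)
  have E: "?E B \<in> events" if "S \<in> ?\<S>" "B \<in> ?\<B> S" for S B
    using all_occupied(1)[OF B[OF that] p(1) p1] .
  have ev: "(\<Union>B\<in>?\<B> S. ?E B) \<in> events" if "S \<in> ?\<S>" for S
    using fin(1)[OF that] E[OF that] by (intro sets.finite_UN) auto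
  show "dense_event p m n \<in> events"
    unfolding dense_event_def by (rule sets.finite_UN[OF card_rooted(1) ev])
  have E_le: "prob (?E B) \<le> c ^ n" if "S \<in> ?\<S>" "B \<in> ?\<B> S" for S B
  proof -
    have "prob (?E B) = p ^ card B" using all_occupied(2)[OF B[OF that] p(1) p1] .
    also have "\<dots> \<le> (c ^ m) ^ card B" using p by (intro power_mono) (auto simp: c_def)
    also have "\<dots> = c ^ (m * card B)" by (simp add: power_mult)
    also have "\<dots> \<le> c ^ n" using c that by (intro power_decreasing) auto
    finally show ?thesis .
  qed
  have "prob (dense_event p m n) \<le> (\<Sum>S\<in>?\<S>. prob (\<Union>B\<in>?\<B> S. ?E B))"
    unfolding dense_event_def using card_rooted(1) ev
    by (intro finite_measure_subadditive_finite) auto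
  also have "\<dots> \<le> (\<Sum>S\<in>?\<S>. \<Sum>B\<in>?\<B> S. prob (?E B))"
    using fin(1) E by (intro sum_mono finite_measure_subadditive_finite) auto
  also have "\<dots> \<le> (\<Sum>S\<in>?\<S>. \<Sum>B\<in>?\<B> S. c ^ n)" by (intro sum_mono E_le)
  also have "\<dots> \<le> (\<Sum>S\<in>?\<S>. 2 ^ n * c ^ n)"
  proof (rule sum_mono)
    fix S assume "S \<in> ?\<S>"
    then have "real (card (?\<B> S)) \<le> 2 ^ n" using fin(2) of_nat_mono by fastforce
    then show "(\<Sum>B\<in>?\<B> S. c ^ n) \<le> 2 ^ n * c ^ n"
      using c by (simp add: mult_right_mono)
  qed
  also have "\<dots> \<le> real (d ^ (2 * n)) * (2 ^ n * c ^ n)"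
    unfolding sum_constant using c card_rooted(2)
    by (intro mult_right_mono) (auto simp del: of_nat_power)
  also have "\<dots> = (real d ^ 2 * 2 * c) ^ n"
    by (simp add: power_mult power_mult_distrib)
  also have "real d ^ 2 * 2 * c = 1 / 2" using degree_pos by (simp add: c_def field_simps)
  finally show "prob (dense_event p m n) \<le> (1 / 2) ^ n" .
qed

text \<open>
  Almost surely only finitely many of the dense events occur, whereas complete occupation makes
  infinitely many of them occur.
\<close>

lemma no_complete_occupation:
  assumes k: "k > 0" and cheeger: "anchored_cheeger G a + ereal (2 * real k) > ereal (real d)"
  obtains q where "q > 0"
    "\<And>p. 0 \<le> p \<Longrightarrow> p \<le> q \<Longrightarrow>
       measure (configs G p) {\<omega> \<in> space (configs G p). completely_occupied G k \<omega>} = 0"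
proof -
  obtain m N where mN: "\<And>S b. S \<in> anchored_sets G a \<Longrightarrow> N \<le> card S \<Longrightarrow> card S > 0 \<Longrightarrow>
       card (edge_boundary G S) + 2 * k * card S \<le> d * card S + 2 * k * b \<Longrightarrow> card S \<le> m * b"
    using cheeger_density[OF assms] by metis
  define q where "q = (1 / (4 * real d ^ 2)) ^ m"
  have "q > 0" using degree_pos by (simp add: q_def)
  moreover have "measure (configs G p) {\<omega> \<in> space (configs G p). completely_occupied G k \<omega>} = 0"
    if p: "0 \<le> p" "p \<le> q" for p
  proof -
    interpret prob_space "configs G p" by (rule prob_space_configs)
    note dense = dense_event[OF p(1) p(2)[unfolded q_def]]
    have "AE \<omega> in configs G p. eventually (\<lambda>n. \<omega> \<in> space (configs G p) - dense_event p m n) sequentially"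
    proof (rule borel_cantelli_AE1)
      show "summable (\<lambda>n. prob (dense_event p m n))"
        by (rule summable_comparison_test'[of "\<lambda>n. (1 / 2 :: real) ^ n" 0])
          (use dense(2) in \<open>auto intro: summable_geometric\<close>)
    qed (use dense(1) in \<open>auto simp: emeasure_eq_measure\<close>)
    then have "AE \<omega> in configs G p. \<not> completely_occupied G k \<omega>"
    proof (rule AE_mp, intro AE_I2 impI notI)
      fix \<omega> assume \<omega>: "\<omega> \<in> space (configs G p)" and co: "completely_occupied G k \<omega>"
        and "eventually (\<lambda>n. \<omega> \<in> space (configs G p) - dense_event p m n) sequentially"
      then obtain n0 where n0: "\<And>n. n \<ge> n0 \<Longrightarrow> \<omega> \<notin> dense_event p m n"
        by (auto simp: eventually_sequentially)
      obtain S where S: "rooted S" "max n0 N \<le> card S"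
        "card (edge_boundary G S) + 2 * k * card S \<le> d * card S + 2 * k * card {v \<in> S. \<omega> v}"
        using completely_occupied_rooted[OF co] by metis
      have "card S > 0" using S(1) by (auto simp: rooted_def card_gt_0_iff)
      then have "card S \<le> m * card {v \<in> S. \<omega> v}"
        using mN[OF rooted_in_anchored_sets[OF S(1)] _ _ S(3)] S(2) by auto
      then have "\<omega> \<in> dense_event p m (card S)"
        unfolding dense_event_def using S(1) \<omega>
        by (intro UN_I[of S] UN_I[of "{v \<in> S. \<omega> v}"]) auto
      then show False using n0 S(2) by auto
    qed
    then show ?thesis by (simp add: emeasure_eq_0_AE measure_def)
  qed
  ultimately show ?thesis using that by blast
qed

section \<open>Complete occupation at density one\<close>

lemma countable_verts: "countable (pverts G)"
proof -
  have fin: "finite ((parcs G ^^ n) `` {a}) \<and> (parcs G ^^ n) `` {a} \<subseteq> pverts G" for n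
  proof (induction n)
    case 0 then show ?case using root by auto
  next
    case (Suc n)
    have "(parcs G ^^ Suc n) `` {a} = (\<Union>v\<in>(parcs G ^^ n) `` {a}. {u. (v, u) \<in> parcs G})"
      by auto
    then show ?case using Suc finite_neighbours by (auto dest: arc_verts)
  qed
  have "pverts G \<subseteq> (\<Union>n. (parcs G ^^ n) `` {a})"
    using reachable_from_root by (auto simp: rtrancl_is_UN_relpow)
  moreover have "countable (\<Union>n. (parcs G ^^ n) `` {a})"
    using fin by (intro countable_UN) (auto intro: countable_finite)
  ultimately show ?thesis by (rule countable_subset)
qed

text \<open>
  The condition at a time step involves the finitely many neighbours of \<open>v\<close> only, and so is a finite
  disjunction over the sets of at least \<open>k\<close> of them that may be occupied.
\<close>

lemma measurable_occupied:
  assumes "v \<in> pverts G"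
  shows "Measurable.pred (configs G p) (\<lambda>\<omega>. v \<in> occupied G k \<omega> t)"
  using assms
proof (induction t arbitrary: v)
  case 0
  then show ?case using measurable_coordinate by simp
next
  case (Suc t)
  let ?N = "{u. (v, u) \<in> parcs G}"
  have N: "finite ?N" "\<And>u. u \<in> ?N \<Longrightarrow> u \<in> pverts G"
    using finite_neighbours[OF Suc.prems] by (auto dest: arc_verts)
  have *: "k \<le> card {u \<in> X. (v, u) \<in> parcs G} \<longleftrightarrow> (\<exists>U\<in>{U \<in> Pow ?N. k \<le> card U}. \<forall>u\<in>U. u \<in> X)"
    (is "?l \<longleftrightarrow> ?r") for X
  proof
    assume ?l then show ?r by (intro bexI[of _ "{u \<in> X. (v, u) \<in> parcs G}"]) auto
  next
    assume ?r
    then obtain U where "U \<subseteq> ?N" "k \<le> card U" "U \<subseteq> X" by auto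
    then have "U \<subseteq> {u \<in> X. (v, u) \<in> parcs G}" by auto
    moreover have "finite {u \<in> X. (v, u) \<in> parcs G}" by (rule finite_subset[OF _ N(1)]) auto
    ultimately show ?l using card_mono \<open>k \<le> card U\<close> le_trans by blast
  qed
  have "Measurable.pred (configs G p) (\<lambda>\<omega>. \<exists>U\<in>{U \<in> Pow ?N. k \<le> card U}. \<forall>u\<in>U. u \<in> occupied G k \<omega> t)"
  proof (rule pred_intros_finite(4))
    show "finite {U \<in> Pow ?N. k \<le> card U}" using N(1) by simp
    fix U assume "U \<in> {U \<in> Pow ?N. k \<le> card U}"
    then have "finite U" "\<And>u. u \<in> U \<Longrightarrow> u \<in> pverts G" using N finite_subset by auto
    then show "Measurable.pred (configs G p) (\<lambda>\<omega>. \<forall>u\<in>U. u \<in> occupied G k \<omega> t)"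
      using Suc.IH by (intro pred_intros_finite(3)) auto
  qed
  then show ?case using Suc.IH[OF Suc.prems] Suc.prems by (simp add: *)
qed

lemma complete_occupation_at_one:
  "measure (configs G 1) {\<omega> \<in> space (configs G 1). completely_occupied G k \<omega>} = 1"
proof -
  interpret prob_space "configs G 1" by (rule prob_space_configs)
  have "{\<omega> \<in> space (configs G 1). completely_occupied G k \<omega>} \<in> events"
    unfolding completely_occupied_def
  proof (rule sets.sets_Collect_countable_All'[OF _ countable_verts])
    fix v assume "v \<in> pverts G"
    then have "Measurable.pred (configs G 1) (\<lambda>\<omega>. \<exists>t. v \<in> occupied G k \<omega> t)"
      using measurable_occupied by (intro pred_intros_countable(2)) auto
    then show "{\<omega> \<in> space (configs G 1). \<exists>t. v \<in> occupied G k \<omega> t} \<in> events"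
      by (simp add: pred_def)
  qed
  moreover have "AE \<omega> in configs G 1. completely_occupied G k \<omega>"
  proof -
    have "b" if "b \<in> set_pmf (bernoulli_pmf 1)" for b
      using that by (cases b) (auto simp: set_pmf_iff)
    then have "AE \<omega> in configs G 1. \<forall>v\<in>pverts G. \<omega> v"
      unfolding configs_def
      by (subst AE_ball_countable[OF countable_verts], intro ballI AE_PiM_component)
        (auto simp: AE_measure_pmf_iff measure_pmf.prob_space_axioms)
    then show ?thesis
      by (rule AE_mp) (auto simp: completely_occupied_def intro!: AE_I2 exI[of _ 0])
  qed
  ultimately show ?thesis by (simp add: prob_Collect_eq_1)
qed

lemma critical_prob_pos:
  assumes "k > 0" "anchored_cheeger G a + ereal (2 * real k) > ereal (real d)"
  shows "critical_prob G k > 0"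
proof -
  obtain q where q: "q > 0" "\<And>p. 0 \<le> p \<Longrightarrow> p \<le> q \<Longrightarrow>
       measure (configs G p) {\<omega> \<in> space (configs G p). completely_occupied G k \<omega>} = 0"
    using no_complete_occupation[OF assms] by metis
  have "q \<le> critical_prob G k"
    unfolding critical_prob_def
  proof (rule cInf_greatest)
    have "1 \<in> {p \<in> {0..1}. measure (configs G p) {\<omega> \<in> space (configs G p). completely_occupied G k \<omega>} > 0}"
      using complete_occupation_at_one by simp
    then show "{p \<in> {0..1}. measure (configs G p) {\<omega> \<in> space (configs G p). completely_occupied G k \<omega>} > 0} \<noteq> {}"
      by blast
    fix p
    assume "p \<in> {p \<in> {0..1}. measure (configs G p) {\<omega> \<in> space (configs G p). completely_occupied G k \<omega>} > 0}"
    then have "0 \<le> p" "measure (configs G p) {\<omega> \<in> space (configs G p). completely_occupied G k \<omega>} \<noteq> 0"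
      by auto
    then show "q \<le> p" using q(2) by (metis linear)
  qed
  then show ?thesis using q(1) by simp
qed

end

theorem theorem1p4:
  fixes G :: "'a pair_pre_digraph" and d :: nat and a :: 'a
  assumes "pair_bidirected_digraph G"
    and "infinite (pverts G)"
    and "Digraph_Component.connected (with_proj G)"
    and "regular_graph G d"
    and "a \<in> pverts G"
  shows "(\<forall>k::nat. k > 0 \<longrightarrow> anchored_cheeger G a + ereal (2 * real k) > ereal (real d)
             \<longrightarrow> critical_prob G k > 0)
       \<and> (anchored_expansion G a \<longrightarrow> critical_prob G (nat \<lceil>real d / 2\<rceil>) > 0)"
proof -
  interpret infinite_regular_graph G d a
    using assms by (simp add: infinite_regular_graph_def infinite_regular_graph_axioms_def)
  have "critical_prob G (nat \<lceil>real d / 2\<rceil>) > 0" if exp: "anchored_expansion G a"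
  proof (rule critical_prob_pos)
    let ?k = "nat \<lceil>real d / 2\<rceil>"
    show "?k > 0" using degree_pos by simp
    have "real d \<le> 2 * real ?k" by linarith
    then show "anchored_cheeger G a + ereal (2 * real ?k) > ereal (real d)"
      using exp unfolding anchored_expansion_def by (cases "anchored_cheeger G a") auto
  qed
  then show ?thesis using critical_prob_pos by blast
qed

end
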